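(* Let $\mathbf{B}=(B,\nu,\beta)$ be an arbitrary system (over $\mathbb{Z}$), let $k\in\mathbb{N}=\{1,2,3,\dots\}$, let $I=\{1,\dots,k\}$, and put $\mathbf{A}_\iota=\mathbf{B}$ for all $\iota\in I$. For $\bar n=(n_1,\dots,n_k)\in\mathbb{Z}^k$, let $\Delta_{\bar n}=\nu\circ\delta_{\bar n}$ be the state on $\ast_{\iota\in I}B$, where $\delta_{\bar n}:\ast_{\iota\in I}B\to B$ is the unital $*$-homomorphism determined by $\delta_{\bar n}\circ\psi_\iota=\beta^{n_\iota}$ for all $\iota\in I$. Let $(\Phi_N)_{N\in\mathbb{N}}$ be a F\o lner sequence in the group $\mathbb{Z}^k$. Then $$\bar\Delta_N:=\frac{1}{|\Phi_N|}\sum_{\bar n\in\Phi_N}\Delta_{\bar n}$$ is a joining of $(\mathbf{A}_\iota)_{\iota\in I}$ for every $N\in\mathbb{N}$. Moreover, if $\omega(a):=\lim_{N\to\infty}\bar\Delta_N(a)$ exists for every $a\in\ast_{\iota\in I}B$, then $\omega$ is a joining of $(\mathbf{A}'_\iota)_{\iota\in I}$, where $\mathbf{A}'_\iota:=(B,\nu,\beta^{m_\iota})$, for any $m_1,\dots,m_k\in\mathbb{Z}$.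
   Context: A *system* (over $\mathbb{Z}$) is a triple $\mathbf{B}=(B,\nu,\beta)$ where $B$ is a unital C*-algebra, $\nu$ is a state on $B$ and $\beta$ is a $*$-automorphism of $B$ with $\nu\circ\beta=\nu$; the group $\mathbb{Z}$ acts by $n\mapsto\beta^n$. In particular, for $m\in\mathbb{Z}$, $(B,\nu,\beta^m)$ is the system with $\mathbb{Z}$-action $n\mapsto\beta^{mn}$. Free products and joinings: given systems $\mathbf{A}_\iota=(A_\iota,\mu_\iota,\alpha_\iota)$, $\iota\in I$, let $A=\ast_{\iota\in I}A_\iota$ be the (full) unital C*-algebra free product (the coproduct in the category of unital C*-algebras and unital $*$-homomorphisms), with canonical injective unital $*$-homomorphisms $\psi_\iota:A_\iota\to A$. For $n\in\mathbb{Z}$ let $\alpha^n:A\to A$ be the $*$-automorphism determined by $\alpha^n\circ\psi_\iota=\psi_\iota\circ\alpha_\iota^n$ for all $\iota\in I$. A *joining* of $(\mathbf{A}_\iota)_{\iota\in I}$ is a state $\omega$ on $A$ such that $\omega\circ\psi_\iota=\mu_\iota$ for all $\iota\in I$ and $\omega\circ\alpha^n=\omega$ for all $n\in\mathbb{Z}$. When all $A_\iota=B$, we write $A=\ast_{\iota\in I}B$. A *F\o lner sequence* in $\mathbb{Z}^k$ is a sequence $(\Phi_N)_{N\in\mathbb{N}}$ of finite nonempty subsets of $\mathbb{Z}^k$ such that $|\Phi_N\bigtriangleup(\Phi_N+\bar m)|/|\Phi_N|\to0$ as $N\to\infty$ for every $\bar m\in\mathbb{Z}^k$, where $\bigtriangleup$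 denotes symmetric difference. *)

theory Defs
  imports
    Complex_Main
    "HOL-Library.Nonpos_Ints"
    "HOL-Algebra.Module"
    "HOL-Algebra.Coset"
    "HOL-Algebra.Product_Groups"
    "HOL-Algebra.Algebraic_Closure_Type"
begin

section \<open>Unital C*-algebras, homomorphisms and states\<close>

record 'a cstar = "(complex, 'a) module" +
  adj :: "'a \<Rightarrow> 'a"
  cnorm :: "'a \<Rightarrow> real"

text \<open>The zero algebra is allowed (it is the terminal object of the category); it carries no
  state.\<close>

locale unital_cstar_algebra =
  module "ring_of_type_algebra :: complex ring" A + ring A
  for A :: "'a cstar" (structure) +
  assumes smult_mult_left:
      "\<lbrakk>x \<in> carrier A; y \<in> carrier A\<rbrakk> \<Longrightarrow> (c \<odot> x) \<otimes> y = c \<odot> (x \<otimes> y)"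
    and smult_mult_right:
      "\<lbrakk>x \<in> carrier A; y \<in> carrier A\<rbrakk> \<Longrightarrow> x \<otimes> (c \<odot> y) = c \<odot> (x \<otimes> y)"
    and adj_closed: "x \<in> carrier A \<Longrightarrow> adj A x \<in> carrier A"
    and adj_adj: "x \<in> carrier A \<Longrightarrow> adj A (adj A x) = x"
    and adj_add: "\<lbrakk>x \<in> carrier A; y \<in> carrier A\<rbrakk> \<Longrightarrow> adj A (x \<oplus> y) = adj A x \<oplus> adj A y"
    and adj_smult: "x \<in> carrier A \<Longrightarrow> adj A (c \<odot> x) = cnj c \<odot> adj A x"
    and adj_mult: "\<lbrakk>x \<in> carrier A; y \<in> carrier A\<rbrakk> \<Longrightarrow> adj A (x \<otimes> y) = adj A y \<otimes> adj A x"
    and cnorm_nonneg: "x \<in> carrier A \<Longrightarrow> 0 \<le> cnorm A x"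
    and cnorm_eq_0_iff: "x \<in> carrier A \<Longrightarrow> cnorm A x = 0 \<longleftrightarrow> x = \<zero>"
    and cnorm_triangle:
      "\<lbrakk>x \<in> carrier A; y \<in> carrier A\<rbrakk> \<Longrightarrow> cnorm A (x \<oplus> y) \<le> cnorm A x + cnorm A y"
    and cnorm_smult: "x \<in> carrier A \<Longrightarrow> cnorm A (c \<odot> x) = cmod c * cnorm A x"
    and cnorm_mult_le:
      "\<lbrakk>x \<in> carrier A; y \<in> carrier A\<rbrakk> \<Longrightarrow> cnorm A (x \<otimes> y) \<le> cnorm A x * cnorm A y"
    and cstar_identity: "x \<in> carrier A \<Longrightarrow> cnorm A (adj A x \<otimes> x) = (cnorm A x)\<^sup>2"
    and complete:
      "\<lbrakk>\<And>n::nat. s n \<in> carrier A;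
        \<And>e. e > 0 \<Longrightarrow> \<exists>M. \<forall>m\<ge>M. \<forall>n\<ge>M. cnorm A (s m \<ominus> s n) < e\<rbrakk>
       \<Longrightarrow> \<exists>x\<in>carrier A. (\<lambda>n. cnorm A (s n \<ominus> x)) \<longlonglongrightarrow> 0"

text \<open>Unital *-homomorphisms; note that \<open>ring_hom\<close> preserves the unit. Only the values on the
  carrier matter.\<close>

definition cstar_hom :: "'a cstar \<Rightarrow> 'b cstar \<Rightarrow> ('a \<Rightarrow> 'b) set" where
  "cstar_hom A B = {f \<in> ring_hom A B.
     (\<forall>c. \<forall>x\<in>carrier A. f (c \<odot>\<^bsub>A\<^esub> x) = c \<odot>\<^bsub>B\<^esub> f x) \<and>
     (\<forall>x\<in>carrier A. f (adj A x) = adj B (f x))}"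

definition cstar_aut :: "'a cstar \<Rightarrow> ('a \<Rightarrow> 'a) set" where
  "cstar_aut A = {f \<in> cstar_hom A A. bij_betw f (carrier A) (carrier A)}"

definition aut_zpow :: "'a cstar \<Rightarrow> ('a \<Rightarrow> 'a) \<Rightarrow> int \<Rightarrow> 'a \<Rightarrow> 'a" where
  "aut_zpow A f n =
     (if 0 \<le> n then f ^^ nat n else inv_into (carrier A) f ^^ nat (- n))"

definition cstar_state :: "'a cstar \<Rightarrow> ('a \<Rightarrow> complex) \<Rightarrow> bool" where
  "cstar_state A \<omega> \<longleftrightarrow>
     (\<forall>x\<in>carrier A. \<forall>y\<in>carrier A. \<omega> (x \<oplus>\<^bsub>A\<^esub> y) = \<omega> x + \<omega> y) \<and>
     (\<forall>c. \<forall>x\<in>carrier A. \<omega> (c \<odot>\<^bsub>A\<^esub> x) = c * \<omega> x) \<and>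
     (\<forall>x\<in>carrier A. \<omega> (adj A x \<otimes>\<^bsub>A\<^esub> x) \<in> \<real>\<^sub>\<ge>\<^sub>0) \<and>
     \<omega> \<one>\<^bsub>A\<^esub> = 1"


section \<open>Systems over the integers\<close>

record 'b system =
  alg :: "'b cstar"
  state :: "'b \<Rightarrow> complex"
  aut :: "'b \<Rightarrow> 'b"

definition is_system :: "'b system \<Rightarrow> bool" where
  "is_system S \<longleftrightarrow>
     unital_cstar_algebra (alg S) \<and>
     cstar_state (alg S) (state S) \<and>
     aut S \<in> cstar_aut (alg S) \<and>
     (\<forall>b\<in>carrier (alg S). state S (aut S b) = state S b)"

abbreviation action :: "'b system \<Rightarrow> int \<Rightarrow> 'b \<Rightarrow> 'b" where
  "action S \<equiv> aut_zpow (alg S) (aut S)"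

definition system_power :: "'b system \<Rightarrow> int \<Rightarrow> 'b system" where
  "system_power S m = \<lparr>alg = alg S, state = state S, aut = action S m\<rparr>"


section \<open>The unital free product\<close>

definition extends_family ::
  "'i set \<Rightarrow> ('i \<Rightarrow> 'b cstar) \<Rightarrow> ('i \<Rightarrow> 'b \<Rightarrow> 'a) \<Rightarrow> ('i \<Rightarrow> 'b \<Rightarrow> 'd) \<Rightarrow> ('a \<Rightarrow> 'd) \<Rightarrow> bool" where
  "extends_family I Bs \<psi> \<phi> f \<longleftrightarrow> (\<forall>i\<in>I. \<forall>b\<in>carrier (Bs i). f (\<psi> i b) = \<phi> i b)"

text \<open>\<open>(A, \<psi>)\<close> is a coproduct of the family \<open>Bs\<close> in the category of unital C*-algebras.
  HOL cannot quantify over all types inside a formula, so the test algebras \<open>D\<close> are those whose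
  carrier is a subset of the type of \<open>A\<close>. Every coproduct in the unrestricted sense satisfies this,
  so hypothesizing the predicate covers all of them. For a nonempty finite family of nonzero
  algebras the restriction moreover loses nothing: existence and uniqueness only concern the
  C*-subalgebra of \<open>D\<close> generated by images of the \<open>Bs i\<close> (or of \<open>A\<close>); its cardinality is at most
  that of \<open>A\<close>, because \<open>\<psi> i\<close> is injective and \<open>\<kappa>\<close> to the power aleph-zero is \<open>\<kappa>\<close> for the
  cardinality \<open>\<kappa>\<close> of a nonzero complex Banach space, so it has a copy inside the type of \<open>A\<close>.
  Lemma \<open>coproduct_universal\<close> below carries out the transport to other types.\<close>

definition cstar_coproduct ::
  "'i set \<Rightarrow> ('i \<Rightarrow> 'b cstar) \<Rightarrow> 'a cstar \<Rightarrow> ('i \<Rightarrow> 'b \<Rightarrow> 'a) \<Rightarrow> bool" where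
  "cstar_coproduct I Bs A \<psi> \<longleftrightarrow>
     unital_cstar_algebra A \<and>
     (\<forall>i\<in>I. \<psi> i \<in> cstar_hom (Bs i) A \<and> inj_on (\<psi> i) (carrier (Bs i))) \<and>
     (\<forall>(D :: 'a cstar) \<phi>.
        unital_cstar_algebra D \<and> (\<forall>i\<in>I. \<phi> i \<in> cstar_hom (Bs i) D) \<longrightarrow>
        (\<exists>!f. f \<in> cstar_hom A D \<and> f \<in> extensional (carrier A) \<and> extends_family I Bs \<psi> \<phi> f))"

text \<open>The homomorphism determined by its compositions with the canonical embeddings;
  \<open>extensional\<close> fixes its irrelevant values outside the carrier.\<close>

definition coproduct_lift ::
  "'i set \<Rightarrow> ('i \<Rightarrow> 'b cstar) \<Rightarrow> 'a cstar \<Rightarrow> ('i \<Rightarrow> 'b \<Rightarrow> 'a) \<Rightarrow>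
   'd cstar \<Rightarrow> ('i \<Rightarrow> 'b \<Rightarrow> 'd) \<Rightarrow> 'a \<Rightarrow> 'd" where
  "coproduct_lift I Bs A \<psi> D \<phi> =
     (THE f. f \<in> cstar_hom A D \<and> f \<in> extensional (carrier A) \<and> extends_family I Bs \<psi> \<phi> f)"


definition transport :: "('d \<Rightarrow> 'a) \<Rightarrow> 'd cstar \<Rightarrow> 'a cstar" where
  "transport e D = (let g = inv_into (carrier D) e in
     \<lparr>carrier = e ` carrier D,
      monoid.mult = (\<lambda>x y. e (g x \<otimes>\<^bsub>D\<^esub> g y)), one = e \<one>\<^bsub>D\<^esub>,
      zero = e \<zero>\<^bsub>D\<^esub>, add = (\<lambda>x y. e (g x \<oplus>\<^bsub>D\<^esub> g y)),
      module.smult = (\<lambda>c x. e (c \<odot>\<^bsub>D\<^esub> g x)),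
      adj = (\<lambda>x. e (adj D (g x))), cnorm = (\<lambda>x. cnorm D (g x))\<rparr>)"

lemma carrier_transport: "carrier (transport e D) = e ` carrier D"
  by (simp add: transport_def Let_def)

lemma unital_cstar_algebra_transport:
  assumes D: "unital_cstar_algebra D" and e: "inj_on e (carrier D)"
  shows "unital_cstar_algebra (transport e D)"
proof -
  interpret D: unital_cstar_algebra D by (rule D)
  let ?T = "transport e D"
  have smult_closed [simp]: "c \<odot>\<^bsub>D\<^esub> x \<in> carrier D" if "x \<in> carrier D" for c x
    using D.smult_closed[of c x] that by (simp add: ring_of_type_algebra_def)
  note [simp] = carrier_transport D.adj_closed
  have g [simp]: "inv_into (carrier D) e (e x) = x" if "x \<in> carrier D" for x
    using e that by simp
  have ops [simp]:
    "x \<in> carrier D \<Longrightarrow> y \<in> carrier D \<Longrightarrow> e x \<otimes>\<^bsub>?T\<^esub> e y = e (x \<otimes>\<^bsub>D\<^esub> y)"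
    "x \<in> carrier D \<Longrightarrow> y \<in> carrier D \<Longrightarrow> e x \<oplus>\<^bsub>?T\<^esub> e y = e (x \<oplus>\<^bsub>D\<^esub> y)"
    "x \<in> carrier D \<Longrightarrow> c \<odot>\<^bsub>?T\<^esub> e x = e (c \<odot>\<^bsub>D\<^esub> x)"
    "x \<in> carrier D \<Longrightarrow> adj ?T (e x) = e (adj D x)"
    "x \<in> carrier D \<Longrightarrow> cnorm ?T (e x) = cnorm D x"
    "\<one>\<^bsub>?T\<^esub> = e \<one>\<^bsub>D\<^esub>" "\<zero>\<^bsub>?T\<^esub> = e \<zero>\<^bsub>D\<^esub>"
    for x y c
    by (simp_all add: transport_def Let_def)
  have ring: "ring ?T"
  proof (rule ringI)
    show "abelian_group ?T"
    proof (rule abelian_groupI)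
      fix x assume "x \<in> carrier ?T"
      then obtain a where a: "a \<in> carrier D" "x = e a" by auto
      show "\<exists>y\<in>carrier ?T. y \<oplus>\<^bsub>?T\<^esub> x = \<zero>\<^bsub>?T\<^esub>"
        using a by (intro bexI[of _ "e (\<ominus>\<^bsub>D\<^esub> a)"]) (auto simp: D.l_neg)
    qed (auto simp: D.a_ac)
    show "monoid ?T"
      by (rule monoidI) (auto simp: D.m_assoc)
  qed (auto simp: D.l_distr D.r_distr)
  interpret T: ring ?T by (rule ring)
  have neg: "\<ominus>\<^bsub>?T\<^esub> e x = e (\<ominus>\<^bsub>D\<^esub> x)" if "x \<in> carrier D" for x
    by (rule T.minus_equality) (use that in \<open>auto simp: D.l_neg\<close>)
  have minus [simp]: "e x \<ominus>\<^bsub>?T\<^esub> e y = e (x \<ominus>\<^bsub>D\<^esub> y)"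
    if "x \<in> carrier D" "y \<in> carrier D" for x y
    using that by (simp add: a_minus_def neg)
  have module: "module ring_of_type_algebra ?T"
    using D.module_axioms D.smult_l_distr D.smult_r_distr D.smult_assoc1 D.smult_one
    by (intro moduleI T.abelian_group_axioms D.R.cring_axioms) (auto simp: ring_of_type_algebra_def)
  show ?thesis
  proof (intro unital_cstar_algebra.intro module ring unital_cstar_algebra_axioms.intro)
    fix s :: "nat \<Rightarrow> 'b"
    assume s: "\<And>n. s n \<in> carrier ?T"
      and cau: "\<And>r. r > 0 \<Longrightarrow> \<exists>M. \<forall>m\<ge>M. \<forall>n\<ge>M. cnorm ?T (s m \<ominus>\<^bsub>?T\<^esub> s n) < r"
    from s have "\<forall>n. \<exists>a. a \<in> carrier D \<and> s n = e a" by auto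
    then obtain a where a: "\<And>n. a n \<in> carrier D" "\<And>n. s n = e (a n)" by metis
    have "\<exists>x\<in>carrier D. (\<lambda>n. cnorm D (a n \<ominus>\<^bsub>D\<^esub> x)) \<longlonglongrightarrow> 0"
      by (rule D.complete) (use a cau in auto)
    then show "\<exists>x\<in>carrier ?T. (\<lambda>n. cnorm ?T (s n \<ominus>\<^bsub>?T\<^esub> x)) \<longlonglongrightarrow> 0"
      using a by auto
  qed (use e in \<open>auto simp: D.smult_mult_left D.smult_mult_right D.adj_adj D.adj_add D.adj_smult
      D.adj_mult D.cnorm_nonneg D.cnorm_eq_0_iff D.cnorm_triangle D.cnorm_smult D.cnorm_mult_le
      D.cstar_identity inj_on_eq_iff\<close>)
qed

lemma cstar_hom_transport:
  assumes D: "unital_cstar_algebra D" and e: "inj_on e (carrier D)"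
  shows "e \<in> cstar_hom D (transport e D)"
    and "inv_into (carrier D) e \<in> cstar_hom (transport e D) D"
proof -
  interpret D: unital_cstar_algebra D by (rule D)
  have [simp]: "c \<odot>\<^bsub>D\<^esub> x \<in> carrier D" if "x \<in> carrier D" for c x
    using D.smult_closed[of c x] that by (simp add: ring_of_type_algebra_def)
  have [simp]: "inv_into (carrier D) e (e x) = x" if "x \<in> carrier D" for x
    using e that by simp
  note [simp] = D.adj_closed
  show "e \<in> cstar_hom D (transport e D)"
    and "inv_into (carrier D) e \<in> cstar_hom (transport e D) D"
    by (auto simp: cstar_hom_def ring_hom_def transport_def Let_def)
qed

lemma cstar_hom_comp:
  assumes "f \<in> cstar_hom A B" "g \<in> cstar_hom B C"
  shows "g \<circ> f \<in> cstar_hom A C"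
  using assms by (auto simp: cstar_hom_def ring_hom_def Pi_iff)

lemma cstar_hom_restrict:
  assumes "unital_cstar_algebra A"
  shows "restrict f (carrier A) \<in> cstar_hom A B \<longleftrightarrow> f \<in> cstar_hom A B"
proof -
  interpret A: unital_cstar_algebra A by (rule assms)
  have "c \<odot>\<^bsub>A\<^esub> x \<in> carrier A" if "x \<in> carrier A" for c x
    using A.smult_closed[of c x] that by (simp add: ring_of_type_algebra_def)
  then show ?thesis
    using A.adj_closed by (auto simp: cstar_hom_def ring_hom_def Pi_iff)
qed

lemma coproduct_universal:
  fixes D :: "'d cstar" and A :: "'a cstar" and e :: "'d \<Rightarrow> 'a"
  assumes cop: "cstar_coproduct I Bs A \<psi>"
    and D: "unital_cstar_algebra D" and e: "inj_on e (carrier D)"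
    and \<phi>: "\<And>i. i \<in> I \<Longrightarrow> \<phi> i \<in> cstar_hom (Bs i) D"
  shows "\<exists>!f. f \<in> cstar_hom A D \<and> f \<in> extensional (carrier A) \<and> extends_family I Bs \<psi> \<phi> f"
proof -
  let ?T = "transport e D" and ?g = "inv_into (carrier D) e"
  have A: "unital_cstar_algebra A" and \<psi>: "\<And>i. i \<in> I \<Longrightarrow> \<psi> i \<in> cstar_hom (Bs i) A"
    using cop by (auto simp: cstar_coproduct_def)
  note T = unital_cstar_algebra_transport[OF D e]
  note homs = cstar_hom_transport[OF D e]
  have homT: "\<And>i. i \<in> I \<Longrightarrow> e \<circ> \<phi> i \<in> cstar_hom (Bs i) ?T"
    using \<phi> homs(1) by (blast intro: cstar_hom_comp)
  have ex1: "\<exists>!f. f \<in> cstar_hom A ?T \<and> f \<in> extensional (carrier A) \<and>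
      extends_family I Bs \<psi> (\<lambda>i. e \<circ> \<phi> i) f"
  proof -
    have "\<And>(D :: 'a cstar) \<phi>. unital_cstar_algebra D \<Longrightarrow> (\<forall>i\<in>I. \<phi> i \<in> cstar_hom (Bs i) D) \<Longrightarrow>
        \<exists>!f. f \<in> cstar_hom A D \<and> f \<in> extensional (carrier A) \<and> extends_family I Bs \<psi> \<phi> f"
      using cop by (simp add: cstar_coproduct_def)
    from this[OF T] show ?thesis using homT by simp
  qed
  have \<psi>c: "\<psi> i b \<in> carrier A" and \<phi>c: "\<phi> i b \<in> carrier D"
    if "i \<in> I" "b \<in> carrier (Bs i)" for i b
    using \<psi>[OF that(1)] \<phi>[OF that(1)] that(2)
    by (auto simp: cstar_hom_def intro: ring_hom_closed)
  show ?thesis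
  proof (rule ex_ex1I)
    obtain f where f: "f \<in> cstar_hom A ?T" "extends_family I Bs \<psi> (\<lambda>i. e \<circ> \<phi> i) f"
      using ex1_implies_ex[OF ex1] by auto
    have "restrict (?g \<circ> f) (carrier A) \<in> cstar_hom A D"
      using cstar_hom_comp[OF f(1) homs(2)] cstar_hom_restrict[OF A] by blast
    moreover have "extends_family I Bs \<psi> \<phi> (restrict (?g \<circ> f) (carrier A))"
      using f(2) \<psi>c \<phi>c e by (auto simp: extends_family_def)
    ultimately show "\<exists>f. f \<in> cstar_hom A D \<and> f \<in> extensional (carrier A) \<and>
        extends_family I Bs \<psi> \<phi> f"
      by (meson restrict_extensional)
  next
    fix f h
    assume f: "f \<in> cstar_hom A D \<and> f \<in> extensional (carrier A) \<and> extends_family I Bs \<psi> \<phi> f"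
      and h: "h \<in> cstar_hom A D \<and> h \<in> extensional (carrier A) \<and> extends_family I Bs \<psi> \<phi> h"
    have *: "restrict (e \<circ> u) (carrier A) \<in> cstar_hom A ?T \<and>
        restrict (e \<circ> u) (carrier A) \<in> extensional (carrier A) \<and>
        extends_family I Bs \<psi> (\<lambda>i. e \<circ> \<phi> i) (restrict (e \<circ> u) (carrier A))"
      if "u \<in> cstar_hom A D" "extends_family I Bs \<psi> \<phi> u" for u
      using that cstar_hom_comp[OF that(1) homs(1)] cstar_hom_restrict[OF A] \<psi>c
      by (auto simp: extends_family_def)
    have eq: "restrict (e \<circ> f) (carrier A) = restrict (e \<circ> h) (carrier A)"
    proof (rule ex1E[OF ex1])
      fix u
      assume u: "\<forall>v. v \<in> cstar_hom A ?T \<and> v \<in> extensional (carrier A) \<and>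
        extends_family I Bs \<psi> (\<lambda>i. e \<circ> \<phi> i) v \<longrightarrow> v = u"
      show ?thesis
        using u[rule_format, OF *[of f]] u[rule_format, OF *[of h]] f h by simp
    qed
    show "f = h"
    proof (rule extensionalityI[of _ "carrier A"])
      fix x assume x: "x \<in> carrier A"
      have "f x \<in> carrier D" "h x \<in> carrier D"
        using f h x by (auto simp: cstar_hom_def intro: ring_hom_closed)
      moreover have "e (f x) = e (h x)" using fun_cong[OF eq, of x] x by simp
      ultimately show "f x = h x" using e by (auto dest: inj_onD)
    qed (use f h in auto)
  qed
qed

text \<open>In particular the homomorphisms into \<open>Bs j\<close> used below are well defined.\<close>

lemma coproduct_lift_factor:
  assumes "cstar_coproduct I Bs A \<psi>" "j \<in> I" "unital_cstar_algebra (Bs j)"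
    and "\<And>i. i \<in> I \<Longrightarrow> \<phi> i \<in> cstar_hom (Bs i) (Bs j)"
  shows "coproduct_lift I Bs A \<psi> (Bs j) \<phi> \<in> cstar_hom A (Bs j)"
    and "extends_family I Bs \<psi> \<phi> (coproduct_lift I Bs A \<psi> (Bs j) \<phi>)"
proof -
  have "inj_on (\<psi> j) (carrier (Bs j))"
    using assms(1,2) by (auto simp: cstar_coproduct_def)
  from theI'[OF coproduct_universal[OF assms(1,3) this assms(4)]]
  show "coproduct_lift I Bs A \<psi> (Bs j) \<phi> \<in> cstar_hom A (Bs j)"
    and "extends_family I Bs \<psi> \<phi> (coproduct_lift I Bs A \<psi> (Bs j) \<phi>)"
    by (auto simp: coproduct_lift_def)
qed

section \<open>Joinings\<close>

text \<open>In the following definitions \<open>(A, \<psi>)\<close> is meant to be a coproduct of the algebras of the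
  systems \<open>S i\<close>, \<open>i \<in> I\<close>.\<close>

definition coproduct_action ::
  "'i set \<Rightarrow> ('i \<Rightarrow> 'b system) \<Rightarrow> 'a cstar \<Rightarrow> ('i \<Rightarrow> 'b \<Rightarrow> 'a) \<Rightarrow> int \<Rightarrow> 'a \<Rightarrow> 'a" where
  "coproduct_action I S A \<psi> n =
     coproduct_lift I (\<lambda>i. alg (S i)) A \<psi> A (\<lambda>i. \<psi> i \<circ> action (S i) n)"

definition joining ::
  "'i set \<Rightarrow> ('i \<Rightarrow> 'b system) \<Rightarrow> 'a cstar \<Rightarrow> ('i \<Rightarrow> 'b \<Rightarrow> 'a) \<Rightarrow> ('a \<Rightarrow> complex) \<Rightarrow> bool" where
  "joining I S A \<psi> \<omega> \<longleftrightarrow>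
     cstar_state A \<omega> \<and>
     (\<forall>i\<in>I. \<forall>b\<in>carrier (alg (S i)). \<omega> (\<psi> i b) = state (S i) b) \<and>
     (\<forall>n. \<forall>a\<in>carrier A. \<omega> (coproduct_action I S A \<psi> n a) = \<omega> a)"

definition diagonal_state ::
  "nat \<Rightarrow> 'b system \<Rightarrow> 'a cstar \<Rightarrow> (nat \<Rightarrow> 'b \<Rightarrow> 'a) \<Rightarrow> (nat \<Rightarrow> int) \<Rightarrow> 'a \<Rightarrow> complex" where
  "diagonal_state k S A \<psi> n =
     state S \<circ> coproduct_lift {1..k} (\<lambda>_. alg S) A \<psi> (alg S) (\<lambda>i. action S (n i))"

definition averaged_diagonal_state ::
  "nat \<Rightarrow> 'b system \<Rightarrow> 'a cstar \<Rightarrow> (nat \<Rightarrow> 'b \<Rightarrow> 'a) \<Rightarrow> (nat \<Rightarrow> int) set \<Rightarrow> 'a \<Rightarrow> complex" where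
  "averaged_diagonal_state k S A \<psi> F a =
     (\<Sum>n\<in>F. diagonal_state k S A \<psi> n a) / of_nat (card F)"


section \<open>Folner sequences\<close>

abbreviation int_lattice :: "nat \<Rightarrow> (nat \<Rightarrow> int) monoid" where
  "int_lattice k \<equiv> product_group {1..k} (\<lambda>_. integer_group)"

definition folner_sequence :: "('g, 'm) monoid_scheme \<Rightarrow> (nat \<Rightarrow> 'g set) \<Rightarrow> bool" where
  "folner_sequence G \<Phi> \<longleftrightarrow>
     (\<forall>N. finite (\<Phi> N) \<and> \<Phi> N \<noteq> {} \<and> \<Phi> N \<subseteq> carrier G) \<and>
     (\<forall>m\<in>carrier G.
        (\<lambda>N. real (card (sym_diff (\<Phi> N) (\<Phi> N #>\<^bsub>G\<^esub> m))) / real (card (\<Phi> N))) \<longlonglongrightarrow> 0)"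

end

theory Submission
  imports Defs
begin

text \<open>Uniqueness of coproduct lifts gives \<open>\<delta>\<^bsub>n\<^esub> \<circ> \<alpha>\<^sup>j = \<delta>\<^bsub>n + j m\<^esub>\<close>, where \<open>\<alpha>\<close> acts on the \<open>i\<close>-th
  factor by \<open>\<beta>\<close> to the power \<open>m\<^bsub>i\<^esub>\<close>. For constant \<open>m = 1\<close> this is \<open>\<beta>\<^sup>j \<circ> \<delta>\<^bsub>n\<^esub>\<close>, which \<open>\<nu>\<close> does not
  distinguish from \<open>\<delta>\<^bsub>n\<^esub>\<close>, so every diagonal state is invariant. For general \<open>m\<close> the action
  translates the averaging set by \<open>j m\<close>; since all states are bounded by the same multiple of the
  norm, the Folner condition makes the effect vanish in the limit.\<close>

section \<open>Scalars, differences, norm and adjoint in a C*-algebra\<close>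

context unital_cstar_algebra
begin

lemma scale_closed [simp]: "x \<in> carrier A \<Longrightarrow> c \<odot> x \<in> carrier A"
  using smult_closed[of c x] by (simp add: ring_of_type_algebra_def)

lemma scale_add_left: "x \<in> carrier A \<Longrightarrow> (c + d) \<odot> x = c \<odot> x \<oplus> d \<odot> x"
  using smult_l_distr[of c d x] by (simp add: ring_of_type_algebra_def)

lemma scale_add_right:
  "\<lbrakk>x \<in> carrier A; y \<in> carrier A\<rbrakk> \<Longrightarrow> c \<odot> (x \<oplus> y) = c \<odot> x \<oplus> c \<odot> y"
  using smult_r_distr[of c x y] by (simp add: ring_of_type_algebra_def)

lemma scale_scale: "x \<in> carrier A \<Longrightarrow> c \<odot> (d \<odot> x) = (c * d) \<odot> x"
  using smult_assoc1[of c d x] by (simp add: ring_of_type_algebra_def)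

lemma scale_one [simp]: "x \<in> carrier A \<Longrightarrow> 1 \<odot> x = x"
  using smult_one[of x] by (simp add: ring_of_type_algebra_def)

lemma scale_zero [simp]: "x \<in> carrier A \<Longrightarrow> 0 \<odot> x = \<zero>"
  using smult_l_null[of x] by (simp add: ring_of_type_algebra_def)

lemma uminus_eq_scale: "x \<in> carrier A \<Longrightarrow> \<ominus> x = (-1) \<odot> x"
  by (rule minus_equality) (use scale_add_left[of x "-1" 1] in simp_all)

lemma scale_diff_right:
  "\<lbrakk>x \<in> carrier A; y \<in> carrier A\<rbrakk> \<Longrightarrow> c \<odot> (x \<ominus> y) = c \<odot> x \<ominus> c \<odot> y"
  by (simp add: a_minus_def uminus_eq_scale scale_add_right scale_scale mult.commute)

lemma cnorm_uminus: "x \<in> carrier A \<Longrightarrow> cnorm A (\<ominus> x) = cnorm A x"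
  by (simp add: uminus_eq_scale cnorm_smult)

lemma cnorm_zero [simp]: "cnorm A \<zero> = 0"
  by (simp add: cnorm_eq_0_iff)

lemma cnorm_minus_commute:
  assumes "x \<in> carrier A" "y \<in> carrier A"
  shows "cnorm A (x \<ominus> y) = cnorm A (y \<ominus> x)"
proof -
  have "\<ominus> (x \<ominus> y) = y \<ominus> x"
    using assms by (simp add: a_minus_def minus_add a_comm)
  then show ?thesis
    using assms cnorm_uminus[of "x \<ominus> y"] by simp
qed

lemma minus_split:
  assumes "x \<in> carrier A" "y \<in> carrier A" "z \<in> carrier A"
  shows "x \<ominus> z = (x \<ominus> y) \<oplus> (y \<ominus> z)"
  using assms by (simp add: a_minus_def a_assoc r_neg1)

lemma cnorm_minus_triangle:
  assumes "x \<in> carrier A" "y \<in> carrier A" "z \<in> carrier A"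
  shows "cnorm A (x \<ominus> z) \<le> cnorm A (x \<ominus> y) + cnorm A (y \<ominus> z)"
  using assms minus_split[OF assms] by (simp add: cnorm_triangle)

text \<open>The C*-identity and submultiplicativity give one inequality after cancelling a factor
  \<open>cnorm A y\<close>; applying it to the adjoint gives the other.\<close>

lemma cnorm_adj:
  assumes x: "x \<in> carrier A"
  shows "cnorm A (adj A x) = cnorm A x"
proof -
  have le: "cnorm A y \<le> cnorm A (adj A y)" if y: "y \<in> carrier A" for y
  proof (cases "cnorm A y = 0")
    case False
    have "cnorm A y * cnorm A y \<le> cnorm A (adj A y) * cnorm A y"
      using cstar_identity[OF y] cnorm_mult_le[OF adj_closed[OF y] y]
      by (simp add: power2_eq_square)
    then show ?thesis
      using False cnorm_nonneg[OF y] by simp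
  qed (simp add: y adj_closed cnorm_nonneg)
  show ?thesis
    using le[OF x] le[OF adj_closed[OF x]] x by (simp add: adj_adj)
qed

text \<open>The adjoint of the unit equals its product with the unit, an element of the form
  \<open>x* x\<close>, and is therefore selfadjoint; taking adjoints again returns the unit.\<close>

lemma adj_one: "adj A \<one> = \<one>"
proof -
  have "adj A (adj A \<one> \<otimes> \<one>) = adj A \<one> \<otimes> \<one>"
    by (simp add: adj_mult adj_adj adj_closed del: r_one)
  then show ?thesis
    by (simp add: adj_adj adj_closed)
qed

section \<open>Square roots by iteration and a uniform norm bound for states\<close>

lemma cnorm_square_diff_le:
  assumes y: "y \<in> carrier A" and z: "z \<in> carrier A"
  shows "cnorm A (y \<otimes> y \<ominus> z \<otimes> z) \<le> (cnorm A y + cnorm A z) * cnorm A (y \<ominus> z)"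
proof -
  \<comment> \<open>This splitting does not require \<open>y\<close> and \<open>z\<close> to
    commute: the two terms \<open>y z\<close> cancel.\<close>
  have "y \<otimes> y \<ominus> z \<otimes> z = y \<otimes> (y \<ominus> z) \<oplus> (y \<ominus> z) \<otimes> z"
    using y z by (simp add: a_minus_def l_distr r_distr l_minus r_minus a_assoc r_neg1)
  also have "cnorm A \<dots> \<le> cnorm A (y \<otimes> (y \<ominus> z)) + cnorm A ((y \<ominus> z) \<otimes> z)"
    using y z by (simp add: cnorm_triangle)
  also have "\<dots> \<le> cnorm A y * cnorm A (y \<ominus> z) + cnorm A (y \<ominus> z) * cnorm A z"
    using y z by (intro add_mono cnorm_mult_le) auto
  finally show ?thesis
    by (simp add: algebra_simps)
qed

text \<open>The fixed point \<open>y\<close> satisfies \<open>(1 - y)\<^sup>2 = 1 - x\<close>, so this is a square root without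
  functional calculus; the map is a contraction of the ball of radius \<open>1/2\<close>.\<close>

lemma selfadjoint_fixed_point:
  assumes x: "x \<in> carrier A" "adj A x = x" "cnorm A x \<le> 1 / 2"
  shows "\<exists>y\<in>carrier A. adj A y = y \<and> y = (1 / 2) \<odot> (x \<oplus> y \<otimes> y)"
proof -
  define T where "T y = (1 / 2) \<odot> (x \<oplus> y \<otimes> y)" for y
  have T_closed [simp]: "T y \<in> carrier A" if "y \<in> carrier A" for y
    using that x by (simp add: T_def)
  have T_ball: "cnorm A (T y) \<le> 1 / 2" if "y \<in> carrier A" "cnorm A y \<le> 1 / 2" for y
  proof -
    have "cnorm A (x \<oplus> y \<otimes> y) \<le> cnorm A x + cnorm A y * cnorm A y"
      using that x cnorm_triangle[of x "y \<otimes> y"] cnorm_mult_le[of y y] by simp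
    \<comment> \<open>The factor \<open>1/2\<close> in \<open>T\<close> turns this 3/4 into 3/8, so
      the ball is mapped into itself.\<close>
    also have "\<dots> \<le> 1 / 2 + 1 / 2 * (1 / 2)"
      using that x by (intro add_mono mult_mono) (auto simp: cnorm_nonneg)
    finally show ?thesis
      using that x by (simp add: T_def cnorm_smult)
  qed
  have T_contr: "cnorm A (T y \<ominus> T z) \<le> cnorm A (y \<ominus> z) / 2"
    if "y \<in> carrier A" "cnorm A y \<le> 1 / 2" "z \<in> carrier A" "cnorm A z \<le> 1 / 2" for y z
  proof -
    have "(x \<oplus> y \<otimes> y) \<ominus> (x \<oplus> z \<otimes> z) = (y \<otimes> y \<oplus> x) \<ominus> (z \<otimes> z \<oplus> x)"
      using that x by (simp add: a_comm)
    also have "\<dots> = y \<otimes> y \<ominus> z \<otimes> z"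
      using that x by (simp add: a_minus_def minus_add a_comm[of "\<ominus> (z \<otimes> z)"] a_assoc r_neg2)
    finally have "T y \<ominus> T z = (1 / 2) \<odot> (y \<otimes> y \<ominus> z \<otimes> z)"
      using that x by (simp add: T_def flip: scale_diff_right)
    then have "cnorm A (T y \<ominus> T z) = cnorm A (y \<otimes> y \<ominus> z \<otimes> z) / 2"
      using that by (simp add: cnorm_smult)
    \<comment> \<open>On the ball the two norms add up to at most 1, so the factor
      \<open>1/2\<close> in \<open>T\<close> survives as the contraction constant.\<close>
    moreover have "(cnorm A y + cnorm A z) * cnorm A (y \<ominus> z) \<le> 1 * cnorm A (y \<ominus> z)"
      using that by (intro mult_right_mono) (auto simp: cnorm_nonneg)
    ultimately show ?thesis
      using cnorm_square_diff_le[of y z] that by simp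
  qed
  define s where "s n = (T ^^ n) \<zero>" for n
  have s_Suc: "s (Suc n) = T (s n)" for n
    by (simp add: s_def)
  have s: "s n \<in> carrier A \<and> cnorm A (s n) \<le> 1 / 2" for n
    using T_ball by (induction n) (simp_all add: s_Suc s_def)
  \<comment> \<open>The iteration starts at zero, so the case \<open>n = 0\<close> is just the ball
    estimate; each further application of \<open>T\<close> halves the distance.\<close>
  have s_diff: "cnorm A (s (n + d) \<ominus> s n) \<le> (1 / 2) ^ n" for n d
  proof (induction n)
    case 0
    have "s d \<ominus> \<zero> = s d"
      using s by (simp add: a_minus_def)
    then show ?case
      using s[of d] by (simp add: s_def)
  next
    case (Suc n)
    have "cnorm A (s (Suc n + d) \<ominus> s (Suc n)) \<le> cnorm A (s (n + d) \<ominus> s n) / 2"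
      using T_contr s by (simp add: s_Suc)
    then show ?case
      using Suc by simp
  qed
  have "\<exists>y\<in>carrier A. (\<lambda>n. cnorm A (s n \<ominus> y)) \<longlonglongrightarrow> 0"
  proof (rule complete)
    fix e :: real
    assume "e > 0"
    then obtain M where M: "(1 / 2) ^ M < e / 2"
      using real_arch_pow_inv[of "e / 2" "1 / 2"] by auto
    have "cnorm A (s m \<ominus> s n) < e" if "m \<ge> M" "n \<ge> M" for m n
    proof -
      have "cnorm A (s m \<ominus> s n) \<le> cnorm A (s m \<ominus> s M) + cnorm A (s n \<ominus> s M)"
        using cnorm_minus_triangle[of "s m" "s M" "s n"] cnorm_minus_commute[of "s n" "s M"] s
        by simp
      also have "\<dots> \<le> (1 / 2) ^ M + (1 / 2) ^ M"
        using s_diff[of M "m - M"] s_diff[of M "n - M"] that by simp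
      also have "\<dots> < e"
        using M by simp
      finally show ?thesis .
    qed
    then show "\<exists>M. \<forall>m\<ge>M. \<forall>n\<ge>M. cnorm A (s m \<ominus> s n) < e"
      by blast
  qed (use s in blast)
  then obtain y where y: "y \<in> carrier A" and lim: "(\<lambda>n. cnorm A (s n \<ominus> y)) \<longlonglongrightarrow> 0"
    by blast
  \<comment> \<open>The limit stays in the ball, as \<open>T_contr\<close> demands of its
    arguments.\<close>
  have y_ball: "cnorm A y \<le> 1 / 2"
  proof (rule LIMSEQ_le_const)
    show "(\<lambda>n. 1 / 2 + cnorm A (s n \<ominus> y)) \<longlonglongrightarrow> 1 / 2"
      using tendsto_add[OF tendsto_const lim] by simp
    have "cnorm A y \<le> 1 / 2 + cnorm A (s n \<ominus> y)" for n
      using cnorm_minus_triangle[of y "s n" \<zero>] cnorm_minus_commute[of y "s n"] y s[of n]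
      by (simp add: a_minus_def)
    then show "\<exists>N. \<forall>n\<ge>N. cnorm A y \<le> 1 / 2 + cnorm A (s n \<ominus> y)"
      by blast
  qed
  have eqI: "u = v" if "u \<in> carrier A" "v \<in> carrier A" "cnorm A (u \<ominus> v) \<le> 0" for u v
  proof -
    have "u \<ominus> v = \<zero>"
      using that cnorm_nonneg[of "u \<ominus> v"] by (simp flip: cnorm_eq_0_iff)
    then show ?thesis
      using that by simp
  qed
  have fixed: "T y = y"
  proof (rule eqI)
    show "cnorm A (T y \<ominus> y) \<le> 0"
    proof (rule LIMSEQ_le_const)
      show "(\<lambda>n. cnorm A (s n \<ominus> y) + cnorm A (s (Suc n) \<ominus> y)) \<longlonglongrightarrow> 0"
        using tendsto_add[OF lim LIMSEQ_Suc[OF lim]] by simp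
      \<comment> \<open>Pass through \<open>s (Suc n) = T (s n)\<close> and contract the first
        distance.\<close>
      have "cnorm A (T y \<ominus> y) \<le> cnorm A (s n \<ominus> y) + cnorm A (s (Suc n) \<ominus> y)" for n
        using cnorm_minus_triangle[of "T y" "s (Suc n)" y] T_contr[of y "s n"] y y_ball s[of n]
          cnorm_nonneg[of "s n \<ominus> y"] cnorm_minus_commute[of y "s n"]
        by (simp add: s_Suc)
      then show "\<exists>N. \<forall>n\<ge>N. cnorm A (T y \<ominus> y) \<le>
          cnorm A (s n \<ominus> y) + cnorm A (s (Suc n) \<ominus> y)"
        by blast
    qed
  qed (use y in auto)
  \<comment> \<open>Since \<open>x\<close> is selfadjoint, \<open>T\<close> commutes with the
    adjoint. Hence the adjoint of \<open>y\<close> is a second fixed point in the ball, and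
    contraction forces the two to coincide.\<close>
  have T_adj: "adj A (T z) = T (adj A z)" if "z \<in> carrier A" for z
    using that x by (simp add: T_def adj_smult adj_add adj_mult)
  have "adj A y = y"
  proof (rule eqI)
    have "cnorm A (T (adj A y) \<ominus> T y) \<le> cnorm A (adj A y \<ominus> y) / 2"
      using T_contr[of "adj A y" y] y y_ball by (simp add: adj_closed cnorm_adj)
    then show "cnorm A (adj A y \<ominus> y) \<le> 0"
      using T_adj[OF y] fixed by simp
  qed (use y in \<open>auto simp: adj_closed\<close>)
  then show ?thesis
    using y fixed by (auto simp: T_def)
qed

text \<open>With \<open>y\<close> the fixed point, \<open>1 - x\<close> is the square of the
  selfadjoint element \<open>1 - y\<close>, and states are nonnegative on such squares.\<close>

lemma cstar_state_le_one:
  assumes \<omega>: "cstar_state A \<omega>"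
    and x: "x \<in> carrier A" "adj A x = x" "cnorm A x \<le> 1 / 2"
  shows "1 - \<omega> x \<in> \<real>\<^sub>\<ge>\<^sub>0"
proof -
  obtain y where y: "y \<in> carrier A" "adj A y = y" and eq: "y = (1 / 2) \<odot> (x \<oplus> y \<otimes> y)"
    using selfadjoint_fixed_point[OF x] by blast
  have add: "\<omega> (u \<oplus> v) = \<omega> u + \<omega> v" if "u \<in> carrier A" "v \<in> carrier A" for u v
    using \<omega> that by (simp add: cstar_state_def)
  have scale: "\<omega> (c \<odot> u) = c * \<omega> u" if "u \<in> carrier A" for c u
    using \<omega> that by (simp add: cstar_state_def)
  let ?z = "\<one> \<oplus> (-1) \<odot> y"
  have z: "?z \<in> carrier A" "adj A ?z = ?z"
    using y by (simp_all add: adj_add adj_one adj_smult)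
  have "\<omega> (?z \<otimes> ?z) = 1 - 2 * \<omega> y + \<omega> (y \<otimes> y)"
    using y \<omega> by (simp add: l_distr r_distr smult_mult_left smult_mult_right add scale scale_scale
        cstar_state_def)
  moreover have "2 * \<omega> y = \<omega> x + \<omega> (y \<otimes> y)"
    using arg_cong[OF eq, of \<omega>] x y by (simp add: add scale mult.commute)
  ultimately have "\<omega> (?z \<otimes> ?z) = 1 - \<omega> x"
    by simp
  moreover have "\<omega> (adj A ?z \<otimes> ?z) \<in> \<real>\<^sub>\<ge>\<^sub>0"
    using \<omega> z(1) unfolding cstar_state_def by blast
  ultimately show ?thesis
    using z(2) by simp
qed

text \<open>Rescale to norm \<open>1/2\<close> and use the previous lemma for both signs: the value
  is then real and lies between -1 and 1.\<close>

lemma cstar_state_selfadjoint_bound: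
  assumes \<omega>: "cstar_state A \<omega>" and x: "x \<in> carrier A" "adj A x = x"
  shows "cmod (\<omega> x) \<le> 2 * cnorm A x"
proof -
  have scale: "\<omega> (c \<odot> u) = c * \<omega> u" if "u \<in> carrier A" for c u
    using \<omega> that by (simp add: cstar_state_def)
  show ?thesis
  proof (cases "x = \<zero>")
    case True
    then show ?thesis
      using scale[of \<zero> 0] by simp
  next
    case False
    define t where "t = 1 / (2 * cnorm A x)"
    have pos: "cnorm A x > 0"
      using False x cnorm_nonneg[of x] cnorm_eq_0_iff[of x] by linarith
    have "1 - \<omega> (complex_of_real r \<odot> x) \<in> \<real>\<^sub>\<ge>\<^sub>0" if "\<bar>r\<bar> = t" for r
      using cstar_state_le_one[OF \<omega>, of "complex_of_real r \<odot> x"] x pos that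
      by (simp add: adj_smult cnorm_smult t_def)
    from this[of t] this[of "-t"]
    have "1 - t * \<omega> x \<in> \<real>\<^sub>\<ge>\<^sub>0" "1 + t * \<omega> x \<in> \<real>\<^sub>\<ge>\<^sub>0"
      using x pos by (simp_all add: scale t_def)
    then have "t * Im (\<omega> x) = 0" "\<bar>t * Re (\<omega> x)\<bar> \<le> 1"
      by (auto simp: complex_nonneg_Reals_iff)
    then have "cmod (t * \<omega> x) \<le> 1"
      using cmod_eq_Re[of "t * \<omega> x"] by simp
    then show ?thesis
      using pos by (simp add: t_def norm_mult norm_divide field_simps)
  qed
qed

text \<open>What matters later is that the constant 4 is the same for all states; its size is
  irrelevant.\<close>

lemma cstar_state_bound:
  assumes \<omega>: "cstar_state A \<omega>" and a: "a \<in> carrier A"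
  shows "cmod (\<omega> a) \<le> 4 * cnorm A a"
proof -
  have add: "\<omega> (u \<oplus> v) = \<omega> u + \<omega> v" if "u \<in> carrier A" "v \<in> carrier A" for u v
    using \<omega> that by (simp add: cstar_state_def)
  have scale: "\<omega> (c \<odot> u) = c * \<omega> u" if "u \<in> carrier A" for c u
    using \<omega> that by (simp add: cstar_state_def)
  \<comment> \<open>These are twice the real part of \<open>a\<close> and minus twice its imaginary
    part, both selfadjoint, so \<open>a\<close> is half of \<open>?h - i ?k\<close>.\<close>
  let ?h = "a \<oplus> adj A a" and ?k = "\<i> \<odot> a \<oplus> (- \<i>) \<odot> adj A a"
  have [simp]: "adj A a \<in> carrier A"
    using a by (rule adj_closed)
  have "cmod (\<omega> ?h) \<le> 2 * cnorm A ?h" "cmod (\<omega> ?k) \<le> 2 * cnorm A ?k"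
    using a by (auto intro!: cstar_state_selfadjoint_bound[OF \<omega>]
        simp: adj_add adj_smult adj_adj a_comm)
  moreover have "cnorm A ?h \<le> 2 * cnorm A a"
    using cnorm_triangle[of a "adj A a"] a by (simp add: cnorm_adj)
  moreover have "cnorm A ?k \<le> 2 * cnorm A a"
    using cnorm_triangle[of "\<i> \<odot> a" "(- \<i>) \<odot> adj A a"] a by (simp add: cnorm_adj cnorm_smult)
  moreover have "2 * \<omega> a = \<omega> ?h - \<i> * \<omega> ?k"
    using a by (simp add: add scale algebra_simps)
  then have "2 * cmod (\<omega> a) \<le> cmod (\<omega> ?h) + cmod (\<omega> ?k)"
    using norm_triangle_ineq4[of "\<omega> ?h" "\<i> * \<omega> ?k"]
    by (metis norm_mult norm_numeral norm_ii mult_1)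
  ultimately show ?thesis
    by simp
qed

end

section \<open>Pulling states back along homomorphisms\<close>

lemma cstar_hom_closed: "\<lbrakk>f \<in> cstar_hom A B; x \<in> carrier A\<rbrakk> \<Longrightarrow> f x \<in> carrier B"
  by (auto simp: cstar_hom_def intro: ring_hom_closed)

lemma cstar_state_comp:
  assumes "cstar_state B \<nu>" "f \<in> cstar_hom A B"
    and adj: "\<And>x. x \<in> carrier A \<Longrightarrow> adj A x \<in> carrier A"
  shows "cstar_state A (\<nu> \<circ> f)"
  unfolding cstar_state_def
proof (intro conjI ballI allI)
  fix x assume x: "x \<in> carrier A"
  show "(\<nu> \<circ> f) (adj A x \<otimes>\<^bsub>A\<^esub> x) \<in> \<real>\<^sub>\<ge>\<^sub>0"
    using assms x adj[OF x] cstar_hom_closed[OF assms(2) x]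
    by (auto simp: cstar_state_def cstar_hom_def ring_hom_mult)
qed (use assms in \<open>auto simp: cstar_state_def cstar_hom_def ring_hom_def Pi_iff\<close>)

section \<open>Integer powers of a bijection of the carrier\<close>

context
  fixes A :: "'a cstar" and f :: "'a \<Rightarrow> 'a"
  assumes f: "bij_betw f (carrier A) (carrier A)"
begin

lemma inv_bij_closed: "x \<in> carrier A \<Longrightarrow> inv_into (carrier A) f x \<in> carrier A"
  using f by (metis bij_betw_def inv_into_into)

lemma aut_zpow_0: "aut_zpow A f 0 x = x"
  by (simp add: aut_zpow_def)

lemma aut_zpow_closed: "x \<in> carrier A \<Longrightarrow> aut_zpow A f n x \<in> carrier A"
proof -
  assume x: "x \<in> carrier A"
  have "(f ^^ p) x \<in> carrier A" "(inv_into (carrier A) f ^^ p) x \<in> carrier A" for p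
    using x f by (induction p) (auto simp: inv_bij_closed bij_betw_apply)
  then show ?thesis
    by (simp add: aut_zpow_def)
qed

lemma aut_zpow_plus_1:
  assumes x: "x \<in> carrier A"
  shows "aut_zpow A f (n + 1) x = f (aut_zpow A f n x)"
proof (cases "0 \<le> n")
  case True
  then show ?thesis
    by (simp add: aut_zpow_def nat_add_distrib)
next
  case False
  \<comment> \<open>The exponent \<open>n + 1\<close> is \<open>- int p\<close>, one application of
    the inverse fewer than \<open>n\<close>; for \<open>p = 0\<close> it already falls under the
    nonnegative branch of \<open>aut_zpow\<close>.\<close>
  define p where "p = nat (- n - 1)"
  have n: "n = - int (Suc p)"
    using False by (simp add: p_def)
  have "aut_zpow A f n x = inv_into (carrier A) f (aut_zpow A f (- int p) x)"
    by (simp add: aut_zpow_def n nat_add_distrib)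
  moreover have "f (inv_into (carrier A) f (aut_zpow A f (- int p) x)) = aut_zpow A f (- int p) x"
    using f aut_zpow_closed[OF x] by (intro bij_betw_inv_into_right)
  ultimately show ?thesis
    by (simp add: n)
qed

text \<open>A two-sided orbit is determined by its value at 0: upwards by the recursion, downwards
  by injectivity of \<open>f\<close>. The power laws follow by exhibiting such orbits, without case
  distinctions on signs.\<close>

lemma aut_zpow_unique:
  assumes x: "x \<in> carrier A"
    and F: "\<And>n. F n \<in> carrier A" "F 0 = x" "\<And>n. F (n + 1) = f (F n)"
  shows "aut_zpow A f n x = F n"
proof (induction n rule: int_induct[of _ 0])
  case base
  then show ?case
    by (simp add: aut_zpow_0 F)
next
  case (step1 n)
  then show ?case
    by (simp add: aut_zpow_plus_1 x F)
next
  case (step2 n)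
  have "f (aut_zpow A f (n - 1) x) = f (F (n - 1))"
    using aut_zpow_plus_1[OF x, of "n - 1"] F(3)[of "n - 1"] step2 by simp
  then show ?case
    using f F(1) aut_zpow_closed[OF x] by (auto simp: bij_betw_def dest: inj_onD)
qed

lemma aut_zpow_add:
  assumes x: "x \<in> carrier A"
  shows "aut_zpow A f (m + n) x = aut_zpow A f m (aut_zpow A f n x)"
  \<comment> \<open>In the variable \<open>m\<close>, the left side is an orbit starting at the
    \<open>n\<close>-th power applied to \<open>x\<close>.\<close>
  using aut_zpow_unique[OF aut_zpow_closed[OF x, of n], of "\<lambda>m. aut_zpow A f (m + n) x" m]
    aut_zpow_closed[OF x] aut_zpow_plus_1[OF x, of "_ + n"]
  by (simp add: ac_simps)

lemma aut_zpow_bij: "bij_betw (aut_zpow A f n) (carrier A) (carrier A)"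
proof (rule bij_betw_byWitness)
  show "\<forall>x\<in>carrier A. aut_zpow A f (- n) (aut_zpow A f n x) = x"
    "\<forall>x\<in>carrier A. aut_zpow A f n (aut_zpow A f (- n) x) = x"
    by (simp_all add: aut_zpow_0 flip: aut_zpow_add)
qed (auto simp: aut_zpow_closed)

end

text \<open>In the variable \<open>n\<close>, the right side is an orbit of the \<open>m\<close>-th
  power of \<open>f\<close>, by the addition law.\<close>

lemma aut_zpow_aut_zpow:
  assumes f: "bij_betw f (carrier A) (carrier A)" and x: "x \<in> carrier A"
  shows "aut_zpow A (aut_zpow A f m) n x = aut_zpow A f (m * n) x"
  using aut_zpow_unique[OF aut_zpow_bij[OF f, of m] x, of "\<lambda>n. aut_zpow A f (m * n) x" n]
    aut_zpow_closed[OF f x] aut_zpow_add[OF f x, of m] aut_zpow_0[OF f]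
  by (simp add: algebra_simps)

section \<open>Automorphisms, and powers of systems\<close>

lemma cstar_hom_inv:
  assumes A: "unital_cstar_algebra A" and f: "f \<in> cstar_aut A"
  shows "inv_into (carrier A) f \<in> cstar_hom A A"
proof -
  interpret A: unital_cstar_algebra A by (rule A)
  let ?g = "inv_into (carrier A) f"
  have hom: "f \<in> cstar_hom A A" and bij: "bij_betw f (carrier A) (carrier A)"
    using f by (auto simp: cstar_aut_def)
  have g: "?g x \<in> carrier A" "f (?g x) = x" if "x \<in> carrier A" for x
    using that bij by (auto simp: inv_bij_closed bij_betw_inv_into_right)
  \<comment> \<open>This reduces every law for the inverse to the same law for
    \<open>f\<close>.\<close>
  have gI: "?g y = x" if "x \<in> carrier A" "f x = y" for x y
    using that bij by (auto simp: bij_betw_inv_into_left)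
  have "?g \<in> ring_hom A A"
    by (rule ring_hom_memI) (use hom g in \<open>auto intro!: gI simp: cstar_hom_def
        ring_hom_mult ring_hom_add ring_hom_one\<close>)
  moreover have "?g (c \<odot>\<^bsub>A\<^esub> x) = c \<odot>\<^bsub>A\<^esub> ?g x" "?g (adj A x) = adj A (?g x)"
    if "x \<in> carrier A" for c x
    using hom g[OF that] by (auto intro!: gI simp: cstar_hom_def A.adj_closed)
  ultimately show ?thesis
    by (simp add: cstar_hom_def)
qed

lemma cstar_hom_funpow: "f \<in> cstar_hom A A \<Longrightarrow> f ^^ n \<in> cstar_hom A A"
proof (induction n)
  case 0
  then show ?case
    by (auto simp: cstar_hom_def ring_hom_def)
next
  case (Suc n)
  then show ?case
    unfolding funpow.simps by (intro cstar_hom_comp)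
qed

lemma cstar_hom_aut_zpow:
  assumes "unital_cstar_algebra A" "f \<in> cstar_aut A"
  shows "aut_zpow A f n \<in> cstar_hom A A"
  using assms cstar_hom_inv[OF assms] by (auto simp: aut_zpow_def cstar_aut_def cstar_hom_funpow)

lemma is_systemD:
  assumes "is_system S"
  shows "unital_cstar_algebra (alg S)" "cstar_state (alg S) (state S)"
    "bij_betw (aut S) (carrier (alg S)) (carrier (alg S))"
    "action S n \<in> cstar_hom (alg S) (alg S)"
  using assms by (auto simp: is_system_def cstar_aut_def intro: cstar_hom_aut_zpow)

lemma state_action:
  assumes S: "is_system S" and b: "b \<in> carrier (alg S)"
  shows "state S (action S n b) = state S b"
proof (induction n rule: int_induct[of _ 0])
  case base
  then show ?case
    by (simp add: aut_zpow_def)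
next
  note bij = is_systemD(3)[OF S]
  have step: "state S (action S (n + 1) b) = state S (action S n b)" for n
    using aut_zpow_plus_1[OF bij b] aut_zpow_closed[OF bij b] S by (simp add: is_system_def)
  {
    case (step1 n)
    then show ?case
      by (simp add: step)
  next
    case (step2 n)
    then show ?case
      using step[of "n - 1"] by simp
  }
qed

lemma is_system_system_power:
  assumes S: "is_system S"
  shows "is_system (system_power S m)"
  using is_systemD[OF S] aut_zpow_bij[OF is_systemD(3)[OF S]] state_action[OF S]
  by (simp add: is_system_def system_power_def cstar_aut_def)

lemma action_system_power:
  assumes "is_system S" "b \<in> carrier (alg S)"
  shows "action (system_power S m) n b = action S (m * n) b"
  using aut_zpow_aut_zpow[OF is_systemD(3)] assms by (simp add: system_power_def)

section \<open>Homomorphisms out of the coproduct\<close>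

lemma coproduct_lift:
  fixes A :: "'a cstar" and D :: "'d cstar" and e :: "'d \<Rightarrow> 'a"
  assumes "cstar_coproduct I Bs A \<psi>" "unital_cstar_algebra D" "inj_on e (carrier D)"
    and "\<And>i. i \<in> I \<Longrightarrow> \<phi> i \<in> cstar_hom (Bs i) D"
  shows "coproduct_lift I Bs A \<psi> D \<phi> \<in> cstar_hom A D"
    and "\<lbrakk>i \<in> I; b \<in> carrier (Bs i)\<rbrakk> \<Longrightarrow> coproduct_lift I Bs A \<psi> D \<phi> (\<psi> i b) = \<phi> i b"
  using theI'[OF coproduct_universal[OF assms]]
  by (auto simp: coproduct_lift_def extends_family_def)

text \<open>Restricted to the carrier, both maps extend the family
  \<open>f \<circ> \<psi> i\<close>, so uniqueness of the extension identifies them.\<close>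

lemma cstar_hom_coproduct_eqI:
  fixes A :: "'a cstar" and D :: "'d cstar" and e :: "'d \<Rightarrow> 'a"
  assumes cop: "cstar_coproduct I Bs A \<psi>"
    and D: "unital_cstar_algebra D" "inj_on e (carrier D)"
    and f: "f \<in> cstar_hom A D" and g: "g \<in> cstar_hom A D"
    and eq: "\<And>i b. \<lbrakk>i \<in> I; b \<in> carrier (Bs i)\<rbrakk> \<Longrightarrow> f (\<psi> i b) = g (\<psi> i b)"
    and a: "a \<in> carrier A"
  shows "f a = g a"
proof -
  have A: "unital_cstar_algebra A" and \<psi>: "\<And>i. i \<in> I \<Longrightarrow> \<psi> i \<in> cstar_hom (Bs i) A"
    using cop by (auto simp: cstar_coproduct_def)
  let ?P = "\<lambda>h. h \<in> cstar_hom A D \<and> h \<in> extensional (carrier A) \<and>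
    extends_family I Bs \<psi> (\<lambda>i. f \<circ> \<psi> i) h"
  have "f \<circ> \<psi> i \<in> cstar_hom (Bs i) D" if "i \<in> I" for i
    using \<psi>[OF that] f by (rule cstar_hom_comp)
  then have "\<exists>!h. ?P h"
    by (rule coproduct_universal[OF cop D])
  moreover have "?P (restrict f (carrier A))" "?P (restrict g (carrier A))"
    using f g eq cstar_hom_closed[OF \<psi>]
    by (auto simp: cstar_hom_restrict[OF A] extends_family_def)
  ultimately have "restrict f (carrier A) = restrict g (carrier A)"
    by (elim ex1E) metis
  then show ?thesis
    using a by (metis restrict_apply')
qed

section \<open>Averages and pointwise limits of states\<close>

lemma cstar_state_average:
  assumes F: "finite F" "F \<noteq> {}" and \<omega>: "\<And>n. n \<in> F \<Longrightarrow> cstar_state A (\<omega> n)"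
  shows "cstar_state A (\<lambda>a. (\<Sum>n\<in>F. \<omega> n a) / of_nat (card F))"
  unfolding cstar_state_def
proof (intro conjI ballI allI)
  fix x assume x: "x \<in> carrier A"
  have "\<omega> n (adj A x \<otimes>\<^bsub>A\<^esub> x) \<in> \<real>\<^sub>\<ge>\<^sub>0" if "n \<in> F" for n
    using \<omega>[OF that] x by (simp add: cstar_state_def)
  then have "(\<Sum>n\<in>F. \<omega> n (adj A x \<otimes>\<^bsub>A\<^esub> x)) \<in> \<real>\<^sub>\<ge>\<^sub>0"
    by (simp add: complex_nonneg_Reals_iff sum_nonneg)
  then show "(\<Sum>n\<in>F. \<omega> n (adj A x \<otimes>\<^bsub>A\<^esub> x)) / of_nat (card F) \<in> \<real>\<^sub>\<ge>\<^sub>0"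
    by (intro nonneg_Reals_divide_I) auto
qed (use F \<omega> in \<open>simp_all add: cstar_state_def sum.distrib sum_distrib_left add_divide_distrib\<close>)

lemma cstar_state_lim:
  assumes A: "unital_cstar_algebra A" and \<omega>: "\<And>N. cstar_state A (\<omega> N)"
    and lim: "\<And>a. a \<in> carrier A \<Longrightarrow> (\<lambda>N. \<omega> N a) \<longlonglongrightarrow> \<rho> a"
  shows "cstar_state A \<rho>"
  unfolding cstar_state_def
proof (intro conjI ballI allI)
  interpret A: unital_cstar_algebra A by (rule A)
  {
    fix x y assume xy: "x \<in> carrier A" "y \<in> carrier A"
    have "(\<lambda>N. \<omega> N (x \<oplus>\<^bsub>A\<^esub> y)) \<longlonglongrightarrow> \<rho> x + \<rho> y"
      using \<omega> xy tendsto_add[OF lim lim, of x y] by (simp add: cstar_state_def)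
    with lim show "\<rho> (x \<oplus>\<^bsub>A\<^esub> y) = \<rho> x + \<rho> y"
      using xy by (blast intro: LIMSEQ_unique A.add.m_closed)
  next
    fix c x assume x: "x \<in> carrier A"
    have "(\<lambda>N. \<omega> N (c \<odot>\<^bsub>A\<^esub> x)) \<longlonglongrightarrow> c * \<rho> x"
      using \<omega> x tendsto_mult_left[OF lim, of x c] by (simp add: cstar_state_def)
    with lim show "\<rho> (c \<odot>\<^bsub>A\<^esub> x) = c * \<rho> x"
      using x by (blast intro: LIMSEQ_unique A.scale_closed)
  next
    fix x assume x: "x \<in> carrier A"
    let ?p = "adj A x \<otimes>\<^bsub>A\<^esub> x"
    have lim_p: "(\<lambda>N. \<omega> N ?p) \<longlonglongrightarrow> \<rho> ?p"
      using x by (intro lim) (simp add: A.adj_closed)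
    \<comment> \<open>Being a nonnegative real is split into two conditions that pass to
      limits.\<close>
    have "0 \<le> Re (\<omega> N ?p)" "Im (\<omega> N ?p) = 0" for N
      using \<omega>[of N] x by (auto simp: cstar_state_def complex_nonneg_Reals_iff)
    then have "0 \<le> Re (\<rho> ?p)" "Im (\<rho> ?p) = 0"
      using LIMSEQ_le_const[OF tendsto_Re[OF lim_p]] LIMSEQ_unique[OF tendsto_Im[OF lim_p]] by auto
    then show "\<rho> ?p \<in> \<real>\<^sub>\<ge>\<^sub>0"
      by (simp add: complex_nonneg_Reals_iff)
  next
    show "\<rho> \<one>\<^bsub>A\<^esub> = 1"
      using \<omega> lim[of "\<one>\<^bsub>A\<^esub>"] by (auto simp: cstar_state_def LIMSEQ_const_iff)
  }
qed

text \<open>The terms over the intersection cancel. This is how the Folner condition becomes an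
  estimate on averages.\<close>

lemma norm_sum_diff_le:
  fixes f :: "'a \<Rightarrow> 'b::real_normed_vector"
  assumes "finite S" "finite T" and C: "\<And>x. x \<in> S \<union> T \<Longrightarrow> norm (f x) \<le> C"
  shows "norm (sum f S - sum f T) \<le> real (card (sym_diff S T)) * C"
proof -
  have "sum f S - sum f T = sum f (S - T) - sum f (T - S)"
    using assms sum.Int_Diff[of S f T] sum.Int_Diff[of T f S] by (simp add: Int_commute)
  also have "norm \<dots> \<le> real (card (S - T)) * C + real (card (T - S)) * C"
    using C by (intro order_trans[OF norm_triangle_ineq4] add_mono sum_norm_bound) auto
  also have "\<dots> = real (card (sym_diff S T)) * C"
    using assms by (subst card_Un_disjoint) (auto simp: algebra_simps)
  finally show ?thesis .
qed

section \<open>Diagonal states and their behaviour under the actions\<close>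

context
  fixes B :: "'b system" and A :: "'a cstar" and \<psi> :: "nat \<Rightarrow> 'b \<Rightarrow> 'a" and k :: nat
  assumes B: "is_system B" and k: "k \<ge> 1" and cop: "cstar_coproduct {1..k} (\<lambda>_. alg B) A \<psi>"
begin

declare One_nat_def [simp del]

abbreviation (input) diagonal_hom :: "(nat \<Rightarrow> int) \<Rightarrow> 'a \<Rightarrow> 'b" where
  "diagonal_hom n \<equiv> coproduct_lift {1..k} (\<lambda>_. alg B) A \<psi> (alg B) (\<lambda>i. action B (n i))"

text \<open>Since \<open>k \<ge> 1\<close> there is a first factor; its embedding injects the
  carrier of \<open>alg B\<close> into the type of \<open>A\<close>, so that \<open>alg B\<close>
  may serve as a target in the universal property.\<close>

lemma
  shows coproduct_algebra: "unital_cstar_algebra A"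
    and coproduct_embedding: "i \<in> {1..k} \<Longrightarrow> \<psi> i \<in> cstar_hom (alg B) A"
    and coproduct_embedding_1: "inj_on (\<psi> 1) (carrier (alg B))"
  using cop k by (auto simp: cstar_coproduct_def)

lemma
  shows diagonal_hom: "diagonal_hom n \<in> cstar_hom A (alg B)"
    and diagonal_hom_embedding:
      "\<lbrakk>i \<in> {1..k}; b \<in> carrier (alg B)\<rbrakk> \<Longrightarrow> diagonal_hom n (\<psi> i b) = action B (n i) b"
  using coproduct_lift[OF cop is_systemD(1)[OF B] coproduct_embedding_1, of "\<lambda>i. action B (n i)"]
    is_systemD(4)[OF B] by blast+

lemma cstar_state_diagonal_state: "cstar_state A (diagonal_state k B A \<psi> n)"
  unfolding diagonal_state_def
  using is_systemD(2)[OF B] diagonal_hom unital_cstar_algebra.adj_closed[OF coproduct_algebra]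
  by (rule cstar_state_comp)

lemma diagonal_state_embedding:
  "\<lbrakk>i \<in> {1..k}; b \<in> carrier (alg B)\<rbrakk> \<Longrightarrow> diagonal_state k B A \<psi> n (\<psi> i b) = state B b"
  by (simp add: diagonal_state_def diagonal_hom_embedding state_action[OF B])

lemma
  assumes S: "\<And>i. is_system (S i)" "\<And>i. alg (S i) = alg B"
  shows coproduct_action: "coproduct_action {1..k} S A \<psi> j \<in> cstar_hom A A"
    and coproduct_action_embedding: "\<lbrakk>i \<in> {1..k}; b \<in> carrier (alg B)\<rbrakk> \<Longrightarrow>
      coproduct_action {1..k} S A \<psi> j (\<psi> i b) = \<psi> i (action (S i) j b)"
proof -
  have "\<psi> i \<circ> action (S i) j \<in> cstar_hom (alg B) A" if "i \<in> {1..k}" for i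
    using is_systemD(4)[OF S(1)[of i], of j] coproduct_embedding[OF that]
    by (simp add: S(2) cstar_hom_comp)
  note lift = coproduct_lift[where \<phi> = "\<lambda>i. \<psi> i \<circ> action (S i) j" and e = id,
      OF cop coproduct_algebra inj_on_id this]
  show "coproduct_action {1..k} S A \<psi> j \<in> cstar_hom A A"
    using lift(1) by (simp add: coproduct_action_def S(2))
  show "\<lbrakk>i \<in> {1..k}; b \<in> carrier (alg B)\<rbrakk> \<Longrightarrow>
      coproduct_action {1..k} S A \<psi> j (\<psi> i b) = \<psi> i (action (S i) j b)"
    using lift(2) by (simp add: coproduct_action_def S(2))
qed

text \<open>Both sides are homomorphisms out of the coproduct, so comparing them on each factor
  suffices. The exponents \<open>p\<close> are left open to serve equal and differing powers of the
  automorphism alike.\<close>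

lemma diagonal_hom_coproduct_action:
  assumes S: "\<And>i. is_system (S i)" "\<And>i. alg (S i) = alg B"
    and p: "\<And>i b. \<lbrakk>i \<in> {1..k}; b \<in> carrier (alg B)\<rbrakk> \<Longrightarrow>
      action B (n i) (action (S i) j b) = action B (p i) b"
    and a: "a \<in> carrier A"
  shows "diagonal_hom n (coproduct_action {1..k} S A \<psi> j a) = diagonal_hom p a"
proof -
  have "(diagonal_hom n \<circ> coproduct_action {1..k} S A \<psi> j) a = diagonal_hom p a"
  proof (rule cstar_hom_coproduct_eqI[OF cop is_systemD(1)[OF B] coproduct_embedding_1])
    show "diagonal_hom n \<circ> coproduct_action {1..k} S A \<psi> j \<in> cstar_hom A (alg B)"
      by (rule cstar_hom_comp[OF coproduct_action[OF S] diagonal_hom])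
    fix i b assume ib: "i \<in> {1..k}" "b \<in> carrier (alg B)"
    have "action (S i) j b \<in> carrier (alg B)"
      using cstar_hom_closed[OF is_systemD(4)[OF S(1)[of i]]] ib(2) by (simp add: S(2))
    then show "(diagonal_hom n \<circ> coproduct_action {1..k} S A \<psi> j) (\<psi> i b) = diagonal_hom p (\<psi> i b)"
      using ib by (simp add: coproduct_action_embedding[OF S] diagonal_hom_embedding p)
  qed (use diagonal_hom a in auto)
  then show ?thesis
    by simp
qed

lemma diagonal_state_shift_all:
  assumes a: "a \<in> carrier A"
  shows "diagonal_state k B A \<psi> (\<lambda>i. n i + j) a = diagonal_state k B A \<psi> n a"
proof -
  have bij: "bij_betw (aut B) (carrier (alg B)) (carrier (alg B))"
    by (rule is_systemD(3)[OF B])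
  \<comment> \<open>On every factor the extra \<open>j\<close> can be applied last, after which the
    invariant state of \<open>B\<close> absorbs it.\<close>
  have "diagonal_hom (\<lambda>i. n i + j) a = (action B j \<circ> diagonal_hom n) a"
  proof (rule cstar_hom_coproduct_eqI[OF cop is_systemD(1)[OF B] coproduct_embedding_1])
    show "action B j \<circ> diagonal_hom n \<in> cstar_hom A (alg B)"
      by (rule cstar_hom_comp[OF diagonal_hom is_systemD(4)[OF B]])
    fix i b assume "i \<in> {1..k}" "b \<in> carrier (alg B)"
    then show "diagonal_hom (\<lambda>i. n i + j) (\<psi> i b) = (action B j \<circ> diagonal_hom n) (\<psi> i b)"
      using aut_zpow_add[OF bij, of b j "n i"] by (simp add: diagonal_hom_embedding add.commute)
  qed (use diagonal_hom[of "\<lambda>i. n i + j"] a in auto)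
  then show ?thesis
    using state_action[OF B cstar_hom_closed[OF diagonal_hom a]]
    by (simp add: diagonal_state_def)
qed

lemma diagonal_state_coproduct_action:
  assumes a: "a \<in> carrier A"
  shows "diagonal_state k B A \<psi> n (coproduct_action {1..k} (\<lambda>_. B) A \<psi> j a) =
    diagonal_state k B A \<psi> n a"
proof -
  have "diagonal_hom n (coproduct_action {1..k} (\<lambda>_. B) A \<psi> j a) = diagonal_hom (\<lambda>i. n i + j) a"
    by (rule diagonal_hom_coproduct_action)
      (use B a aut_zpow_add[OF is_systemD(3)[OF B]] in auto)
  then show ?thesis
    using diagonal_state_shift_all[OF a] by (simp add: diagonal_state_def)
qed

lemma diagonal_state_power_coproduct_action:
  assumes a: "a \<in> carrier A" and t: "t = restrict (\<lambda>i. m i * j) {1..k}"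
  shows "diagonal_state k B A \<psi> n (coproduct_action {1..k} (\<lambda>i. system_power B (m i)) A \<psi> j a) =
    diagonal_state k B A \<psi> (n \<otimes>\<^bsub>int_lattice k\<^esub> t) a"
proof -
  have "diagonal_hom n (coproduct_action {1..k} (\<lambda>i. system_power B (m i)) A \<psi> j a) =
      diagonal_hom (n \<otimes>\<^bsub>int_lattice k\<^esub> t) a"
    \<comment> \<open>Only coordinates in \<open>{1..k}\<close> are compared; there the lattice
      operation is addition, and the \<open>j\<close>-th power of the \<open>m i\<close>-th power
      has exponent \<open>m i * j\<close>.\<close>
    by (rule diagonal_hom_coproduct_action)
      (use B a in \<open>auto simp: is_system_system_power action_system_power t
        aut_zpow_add[OF is_systemD(3)[OF B]], auto simp: system_power_def\<close>)
  then show ?thesis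
    by (simp add: diagonal_state_def)
qed

lemma joining_averaged_diagonal_state:
  assumes F: "finite F" "F \<noteq> {}"
  shows "joining {1..k} (\<lambda>_. B) A \<psi> (averaged_diagonal_state k B A \<psi> F)"
  using F cstar_state_average[OF F cstar_state_diagonal_state, of "\<lambda>n. n"]
  by (simp add: joining_def averaged_diagonal_state_def[abs_def] diagonal_state_embedding
      diagonal_state_coproduct_action)

text \<open>The two averages are sums of the same function over a set and over its translate, so
  they differ by at most the Folner ratio times a bound not depending on \<open>N\<close>.\<close>

lemma averaged_diagonal_state_power_action:
  assumes a: "a \<in> carrier A" and \<Phi>: "folner_sequence (int_lattice k) \<Phi>"
  shows "(\<lambda>N. averaged_diagonal_state k B A \<psi> (\<Phi> N)
      (coproduct_action {1..k} (\<lambda>i. system_power B (m i)) A \<psi> j a) -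
      averaged_diagonal_state k B A \<psi> (\<Phi> N) a) \<longlonglongrightarrow> 0"
proof (rule tendsto_0_le)
  interpret G: group "int_lattice k"
    by simp
  let ?\<Delta> = "\<lambda>n. diagonal_state k B A \<psi> n a"
  let ?C = "4 * cnorm A a"
  \<comment> \<open>The restriction makes \<open>t\<close> an element of the lattice, so the Folner
    condition applies to it.\<close>
  define t where "t = restrict (\<lambda>i. m i * j) {1..k}"
  let ?r = "\<lambda>N. real (card (sym_diff (\<Phi> N) (\<Phi> N #>\<^bsub>int_lattice k\<^esub> t))) / real (card (\<Phi> N))"
  have t: "t \<in> carrier (int_lattice k)"
    by (simp add: t_def)
  show "?r \<longlonglongrightarrow> 0"
    using \<Phi> t by (simp add: folner_sequence_def)
  have "norm (averaged_diagonal_state k B A \<psi> (\<Phi> N)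
      (coproduct_action {1..k} (\<lambda>i. system_power B (m i)) A \<psi> j a) -
      averaged_diagonal_state k B A \<psi> (\<Phi> N) a) \<le> ?r N * ?C" for N
  proof -
    let ?F = "\<Phi> N"
    have F: "finite ?F" "?F \<subseteq> carrier (int_lattice k)"
      using \<Phi> by (auto simp: folner_sequence_def)
    have coset: "?F #>\<^bsub>int_lattice k\<^esub> t = (\<lambda>n. n \<otimes>\<^bsub>int_lattice k\<^esub> t) ` ?F"
      by (auto simp: r_coset_def)
    \<comment> \<open>No two summands are merged when the sum is rewritten over the
      translate.\<close>
    have inj: "inj_on (\<lambda>n. n \<otimes>\<^bsub>int_lattice k\<^esub> t) ?F"
      using F(2) t G.r_cancel by (intro inj_onI) blast
    have "(\<Sum>n\<in>?F. diagonal_state k B A \<psi> n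
        (coproduct_action {1..k} (\<lambda>i. system_power B (m i)) A \<psi> j a)) =
        sum ?\<Delta> (?F #>\<^bsub>int_lattice k\<^esub> t)"
      using diagonal_state_power_coproduct_action[OF a t_def]
      unfolding coset sum.reindex[OF inj] by (simp add: comp_def)
    moreover have "norm (sum ?\<Delta> (?F #>\<^bsub>int_lattice k\<^esub> t) - sum ?\<Delta> ?F) \<le>
        real (card (sym_diff (?F #>\<^bsub>int_lattice k\<^esub> t) ?F)) * ?C"
      using F(1) a by (intro norm_sum_diff_le unital_cstar_algebra.cstar_state_bound
          coproduct_algebra cstar_state_diagonal_state) (auto simp: coset)
    ultimately show ?thesis
      by (simp add: averaged_diagonal_state_def norm_divide divide_right_mono Un_commute
          flip: diff_divide_distrib)
  qed
  then show "\<forall>\<^sub>F N in sequentially. norm (averaged_diagonal_state k B A \<psi> (\<Phi> N)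
      (coproduct_action {1..k} (\<lambda>i. system_power B (m i)) A \<psi> j a) -
      averaged_diagonal_state k B A \<psi> (\<Phi> N) a) \<le> norm (?r N) * ?C"
    by simp
qed

end

theorem theorem4p2:
  fixes B :: "'b system" and A :: "'a cstar" and \<psi> :: "nat \<Rightarrow> 'b \<Rightarrow> 'a"
    and k :: nat and \<Phi> :: "nat \<Rightarrow> (nat \<Rightarrow> int) set"
  assumes "is_system B"
    and "k \<ge> 1"
    and "cstar_coproduct {1..k} (\<lambda>_. alg B) A \<psi>"
    and "folner_sequence (int_lattice k) \<Phi>"
  shows "(\<forall>N. joining {1..k} (\<lambda>_. B) A \<psi> (averaged_diagonal_state k B A \<psi> (\<Phi> N))) \<and>
    ((\<forall>a\<in>carrier A. convergent (\<lambda>N. averaged_diagonal_state k B A \<psi> (\<Phi> N) a)) \<longrightarrow>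
     (\<forall>m :: nat \<Rightarrow> int.
        joining {1..k} (\<lambda>i. system_power B (m i)) A \<psi>
          (\<lambda>a. lim (\<lambda>N. averaged_diagonal_state k B A \<psi> (\<Phi> N) a))))"
proof (intro conjI impI allI)
  note sys = assms(1-3)
  let ?\<Delta> = "\<lambda>N. averaged_diagonal_state k B A \<psi> (\<Phi> N)"
  show avg: "joining {1..k} (\<lambda>_. B) A \<psi> (?\<Delta> N)" for N
    using assms(4) by (intro joining_averaged_diagonal_state[OF sys]) (auto simp: folner_sequence_def)
  fix m :: "nat \<Rightarrow> int"
  assume "\<forall>a\<in>carrier A. convergent (\<lambda>N. ?\<Delta> N a)"
  then have lim: "(\<lambda>N. ?\<Delta> N a) \<longlonglongrightarrow> lim (\<lambda>N. ?\<Delta> N a)" if "a \<in> carrier A" for a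
    using that by (simp flip: convergent_LIMSEQ_iff)
  show "joining {1..k} (\<lambda>i. system_power B (m i)) A \<psi> (\<lambda>a. lim (\<lambda>N. ?\<Delta> N a))"
    unfolding joining_def
  proof (intro conjI ballI allI)
    show "cstar_state A (\<lambda>a. lim (\<lambda>N. ?\<Delta> N a))"
    proof (rule cstar_state_lim[OF coproduct_algebra[OF sys]])
      show "cstar_state A (?\<Delta> N)" for N
        using avg by (simp add: joining_def)
    qed (rule lim)
    \<comment> \<open>On an embedded factor the sequence is constant, each average being a
      joining.\<close>
    show "lim (\<lambda>N. ?\<Delta> N (\<psi> i b)) = state (system_power B (m i)) b"
      if "i \<in> {1..k}" "b \<in> carrier (alg (system_power B (m i)))" for i b
      using avg that by (simp add: joining_def system_power_def)
    fix j a
    assume a: "a \<in> carrier A"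
    let ?\<alpha> = "coproduct_action {1..k} (\<lambda>i. system_power B (m i)) A \<psi> j"
    \<comment> \<open>Convergence is assumed only on the carrier, so \<open>?\<alpha> a\<close> must
      be seen to lie there.\<close>
    have "?\<alpha> \<in> cstar_hom A A"
      by (rule coproduct_action[OF sys])
        (auto simp: is_system_system_power[OF sys(1)], simp add: system_power_def)
    then have "(\<lambda>N. ?\<Delta> N (?\<alpha> a)) \<longlonglongrightarrow> lim (\<lambda>N. ?\<Delta> N (?\<alpha> a))"
      using a by (intro lim) (rule cstar_hom_closed)
    \<comment> \<open>For these powers the averages are shown invariant only asymptotically, which
      is enough in the limit.\<close>
    moreover have "(\<lambda>N. ?\<Delta> N (?\<alpha> a)) \<longlonglongrightarrow> lim (\<lambda>N. ?\<Delta> N a)"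
      using tendsto_add[OF averaged_diagonal_state_power_action[OF sys a assms(4), of m j]
          lim[OF a]] by simp
    ultimately show "lim (\<lambda>N. ?\<Delta> N (?\<alpha> a)) = lim (\<lambda>N. ?\<Delta> N a)"
      by (rule LIMSEQ_unique)
  qed
qed

end
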